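(* Consider the system $\dot x = f(x)$, $y = h(x)$, with $f:\mathbb{R}^{n_x}\to\mathbb{R}^{n_x}$ locally Lipschitz and $h:\mathbb{R}^{n_x}\to\mathbb{R}^{n_y}$ continuous. Let $n_z \ge n_x$, let $\mathcal{O} \subset \mathbb{R}^{n_x}$ be open, let $\mathcal{X}\subset\mathcal{O}$ be compact, let $A\in\mathbb{R}^{n_z\times n_z}$ be Hurwitz and $B\in\mathbb{R}^{n_z\times n_y}$, and let $T:\mathcal{O}\to\mathbb{R}^{n_z}$ be a $C^1$ map such that $$\frac{\partial T}{\partial x}(x) f(x) = A T(x) + B h(x)\qquad \forall x\in\mathcal{X}.$$ For $z\in T(\mathcal{X})$ let $T^-(z) := \{x\in\mathcal{X}: T(x)=z\}$. Assume that: (1) there exists an integer $p\ge 1$ such that $\mathrm{card}(T^-(z))=p$ for every $z\in T(\mathcal{X})$; (2) for each $x\in\mathcal{X}$, the Jacobian matrix $\frac{\partial T}{\partial x}(x)$ has full rank (i.e. rank $n_x$). Let $T^{\rm inv}:\mathbb{R}^{n_z}\rightrightarrows\mathbb{R}^{n_x}$ be a set-valued map that is Lipschitz with respect to the Hausdorff distance, satisfies $T^{\rm inv}(z)=T^-(z)$ for all $z\in T(\mathcal{X})$, and has at most $p$ elements in each $T^{\rm inv}(z)$, $z \in \mathbb{R}^{n_z}$ (such a map exists under (1) and (2)). Let $y:\mathbb{R}_{\ge0}\to\mathbb{R}^{n_y}$ be an output of the system (i.e. $y(t)=h(x(t))$ for all $t \ge 0$, for some solution $x:\mathbb{R}_{\ge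 0}\to\mathbb{R}^{n_x}$) such that: (3) there exist $\bar t>0$ and at least $p$ solutions $x_1,\dots,x_p:[\bar t,+\infty)\to\mathcal{X}$ to $\dot x=f(x)$ (with $p$ as in (1)) such that, for all $i\in\{1,\dots,p\}$, $h(x_i(t))=y(t)$ for all $t\ge\bar t$, and, for all $j\in\{1,\dots,p\}$ with $j\ne i$, $x_i(t)-x_j(t)$ does not converge to zero as $t\to+\infty$; (4) at least one of the following holds: (4a) there exist a solution $z_*$ to $\dot z=Az+By$ and a simply connected subset $\mathcal{C}\subseteq T(\mathcal{X})$ such that $\lim_{t\to+\infty} d(z_*(t),\mathcal{C})=0$; (4b) there exist a solution $z_*$ to $\dot z=Az+By$ and scalars $\tau_o>0$, $\delta>0$ such that, for each $\tau\ge\tau_o$, the set $z_*([\tau,\tau+\delta])$ is simply connected. Then, for any solution $z:\mathbb{R}_{\ge0}\to\mathbb{R}^{n_z}$ to $\dot z=Az+By$ and any continuous function $\hat x:\mathbb{R}_{\ge 0}\to\mathbb{R}^{n_x}$ with $\hat x(t)\in T^{\rm inv}(z(t))$ for all $t\ge0$, there exists a solution $\tilde x:[\bar t,+\infty)\to\mathbb{R}^{n_x}$ to $\dot x=f(x)$ generating $y$ (i.e. $h(\tilde x(t))=y(t)$ for all $t\ge\bar t$) such that $$\lim_{t\to+\infty}|\hat x(t)-\tilde x(t)|=0.$$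
   Context: The Hausdorff distance between subsets $X_a,X_b$ of $\mathbb{R}^n$ is $d_{\mathcal H}(X_a,X_b):=\max\{\delta(X_a,X_b),\delta(X_b,X_a)\}$ with $\delta(X_a,X_b):=\sup_{x_a\in X_a}\inf_{x_b\in X_b}|x_a-x_b|$. A set-valued map $F:\mathbb{R}^m\rightrightarrows\mathbb{R}^n$ (assigning to each point a subset of $\mathbb{R}^n$) is Lipschitz if there is $k>0$ with $d_{\mathcal H}(F(z_a),F(z_b))\le k|z_a-z_b|$ for all $z_a,z_b$. $d(z,\mathcal{C})$ denotes the Euclidean distance from the point $z$ to the set $\mathcal{C}$. A set is simply connected if any loop in it can be continuously contracted, within the set, to a point. A square matrix is Hurwitz if all its eigenvalues have negative real part. *)

theory Defs
  imports "HOL-Analysis.Analysis"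
begin

text \<open>
  Differential equations on a time set \<open>I\<close> (here a closed half-line); at the left end point of
  \<open>I\<close> the derivative is one-sided.
\<close>

definition solves_ode_on :: "(real \<Rightarrow> 'a \<Rightarrow> 'a::real_normed_vector) \<Rightarrow> (real \<Rightarrow> 'a) \<Rightarrow> real set \<Rightarrow> bool"
  where "solves_ode_on F x I \<longleftrightarrow>
    (\<forall>t\<in>I. (x has_vector_derivative F t (x t)) (at t within I))"

text \<open>
  The distance takes values in \<open>[0, \<infinity>]\<close>, so that the suprema and infima are the true ones also for
  unbounded or empty sets. In particular, the distance between an empty and a nonempty set is
  infinite.
\<close>

definition hausdorff_excess :: "'a::metric_space set \<Rightarrow> 'a set \<Rightarrow> ennreal"
  where "hausdorff_excess Xa Xb = (SUP xa\<in>Xa. INF xb\<in>Xb. ennreal (dist xa xb))"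

definition hausdorff_distance :: "'a::metric_space set \<Rightarrow> 'a set \<Rightarrow> ennreal"
  where "hausdorff_distance Xa Xb = max (hausdorff_excess Xa Xb) (hausdorff_excess Xb Xa)"

definition hausdorff_lipschitz :: "('a::metric_space \<Rightarrow> 'b::metric_space set) \<Rightarrow> bool"
  where "hausdorff_lipschitz F \<longleftrightarrow>
    (\<exists>k>0. \<forall>za zb. hausdorff_distance (F za) (F zb) \<le> ennreal (k * dist za zb))"

definition matrix_eigenvalue :: "complex ^ 'n ^ 'n \<Rightarrow> complex \<Rightarrow> bool"
  where "matrix_eigenvalue M c \<longleftrightarrow> (\<exists>v. v \<noteq> 0 \<and> M *v v = c *s v)"

definition hurwitz :: "real ^ 'n ^ 'n \<Rightarrow> bool"
  where "hurwitz A \<longleftrightarrow>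
    (\<forall>c. matrix_eigenvalue (map_matrix complex_of_real A) c \<longrightarrow> Re c < 0)"

text \<open>
  Simple connectedness in the sense that every loop is contractible. Unlike the library's
  \<open>simply_connected\<close>, this does not include path connectedness; the two notions agree on
  path connected sets, as the lemma below shows.
\<close>

definition loops_contractible :: "'a::real_normed_vector set \<Rightarrow> bool"
  where "loops_contractible S \<longleftrightarrow>
    (\<forall>p. path p \<and> path_image p \<subseteq> S \<and> pathfinish p = pathstart p
      \<longrightarrow> (\<exists>a\<in>S. homotopic_loops S p (linepath a a)))"

lemma simply_connected_iff_loops_contractible:
  fixes S :: "'a::real_normed_vector set"
  shows "simply_connected S \<longleftrightarrow> path_connected S \<and> loops_contractible S"
  unfolding simply_connected_eq_contractible_loop_some loops_contractible_def by blast

definition C1_map_on :: "(real ^ 'm \<Rightarrow> real ^ 'n) \<Rightarrow> (real ^ 'm) set \<Rightarrow> bool"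
  where "C1_map_on T U \<longleftrightarrow>
    (\<forall>x\<in>U. T differentiable (at x)) \<and> continuous_on U (\<lambda>x. jacobian T (at x))"

definition preimage_in :: "('a \<Rightarrow> 'b) \<Rightarrow> 'a set \<Rightarrow> 'b \<Rightarrow> 'a set"
  where "preimage_in T X z = {x \<in> X. T x = z}"

end

(*
  Since A is Hurwitz, all solutions of z' = A z + B y converge to each other, in particular z and
  the curves T x_i. By the Lipschitz property, xhat and all x_i approach the p-point fibre
  F t of T through x_1 t. Distinct points of a common fibre have distance at least some eps > 0, so
  two continuous curves that approach F t are either asymptotic or eventually eps/2 apart. Hence
  the p curves x_i are eventually near p distinct points, i.e. near all of F t, and xhat is
  asymptotic to one of them.
*)

theory Submission
  imports
    Defs
    "HOL-Computational_Algebra.Fundamental_Theorem_Algebra"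
    "HOL-Real_Asymp.Real_Asymp"
begin

text \<open>The obstacle is that \<open>z t\<close> need not lie in T(X): there
  \<open>Tinv (z t)\<close> may have fewer than p points, possibly outside X. Hence all curves are
  measured against the fibre over \<open>T (xs 1 t)\<close>, a point that stays in T(X). This fibre
  moves with t, and its points are never joined to continuous branches; what is followed in time is
  only the distance between two given curves, a continuous real function.\<close>

section \<open>Scalar stable equations with vanishing input\<close>

text \<open>The integrating factor exp(-c t) removes the term c w, so that growth is controlled by u
  alone; scaled back, the contribution of u after a late time s stays small and that of
  \<open>w s\<close> decays exponentially.\<close>

lemma scalar_stable_ode_tendsto_0:
  fixes w u :: "real \<Rightarrow> complex"
  assumes ode: "\<And>t. t \<ge> t0 \<Longrightarrow> (w has_vector_derivative c * w t + u t) (at t within {t0..})"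
    and c: "Re c < 0" and u: "(u \<longlongrightarrow> 0) at_top"
  shows "(w \<longlongrightarrow> 0) at_top"
proof (rule tendstoI)
  fix e :: real assume e: "e > 0"
  define a where "a = - Re c"
  have a: "a > 0" using c by (simp add: a_def)
  \<comment> \<open>If \<open>norm (u t) < d\<close>, then integrating d exp(a t) and scaling back
    by exp(-a t) contributes at most d / a = e / 2.\<close>
  define d where "d = e * a / 2"
  have d: "d > 0" using e a by (simp add: d_def)
  have "eventually (\<lambda>t. norm (u t) < d \<and> t \<ge> t0) at_top"
    using tendstoD[OF u d] eventually_ge_at_top[of t0] by eventually_elim simp
  then obtain s where s: "\<And>t. t \<ge> s \<Longrightarrow> norm (u t) < d \<and> t \<ge> t0"
    by (auto simp: eventually_at_top_linorder)
  define \<phi> where "\<phi> t = exp (- (c * of_real t)) * w t" for t :: real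
  have \<phi>': "(\<phi> has_vector_derivative exp (- (c * of_real t)) * u t) (at t within {t0..})"
    if "t \<ge> t0" for t
  proof -
    have "((\<lambda>t. exp (- (c * of_real t))) has_vector_derivative - c * exp (- (c * of_real t)))
        (at t within {t0..})"
      by (rule has_vector_derivative_real_field) (auto intro!: derivative_eq_intros)
    from has_vector_derivative_mult[OF this ode[OF that]] show ?thesis
      unfolding \<phi>_def by (simp add: algebra_simps)
  qed
  have bound: "norm (w t) \<le> exp (- a * (t - s)) * norm (w s) + e / 2" if t: "t > s" for t
  proof -
    have "norm (\<phi> t - \<phi> s) \<le> d / a * exp (a * t) - d / a * exp (a * s)"
    proof (rule differentiable_bound_general[OF t])
      have "continuous_on {t0..} \<phi>"
        using \<phi>' by (auto simp: continuous_on_eq_continuous_within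
            intro: has_vector_derivative_continuous)
      then show "continuous_on {s..t} \<phi>"
        by (rule continuous_on_subset) (use s in auto)
      show "continuous_on {s..t} (\<lambda>t. d / a * exp (a * t))"
        by (intro continuous_intros)
      fix x assume x: "s < x" "x < t"
      then have "x \<in> interior {t0..}" using s[of s] by auto
      then have "at x within {t0..} = at x" by (rule at_within_interior)
      then show "(\<phi> has_vector_derivative exp (- (c * of_real x)) * u x) (at x)"
        using \<phi>'[of x] s[of x] x by simp
      show "((\<lambda>t. d / a * exp (a * t)) has_vector_derivative d * exp (a * x)) (at x)"
        unfolding has_real_derivative_iff_has_vector_derivative[symmetric]
        using a by (auto intro!: derivative_eq_intros)
      show "norm (exp (- (c * of_real x)) * u x) \<le> d * exp (a * x)"
        using s[of x] x by (simp add: norm_mult a_def)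
    qed
    also have "\<dots> \<le> d / a * exp (a * t)" using a d by simp
    finally have "norm (\<phi> t) \<le> norm (\<phi> s) + d / a * exp (a * t)"
      using norm_triangle_ineq2[of "\<phi> t" "\<phi> s"] by linarith
    then have "exp (a * t) * norm (w t) \<le> exp (a * s) * norm (w s) + e / 2 * exp (a * t)"
      using a by (simp add: \<phi>_def norm_mult a_def d_def)
    then have "exp (- (a * t)) * (exp (a * t) * norm (w t))
        \<le> exp (- (a * t)) * (exp (a * s) * norm (w s) + e / 2 * exp (a * t))"
      by (rule mult_left_mono) simp
    then show ?thesis
      by (simp add: algebra_simps flip: exp_add mult.assoc)
  qed
  have "((\<lambda>t. exp (- a * (t - s)) * norm (w s)) \<longlongrightarrow> 0) at_top"
    using a by real_asymp
  from tendstoD[OF this, of "e / 2"] e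
  have "eventually (\<lambda>t. exp (- a * (t - s)) * norm (w s) < e / 2) at_top"
    by (auto simp: dist_norm)
  with eventually_gt_at_top[of s] show "eventually (\<lambda>t. dist (w t) 0 < e) at_top"
    by eventually_elim (use bound in force)
qed

section \<open>Annihilating polynomials of complex matrices\<close>

text \<open>The first DIM + 1 members are too many to be independent. \<open>dependent\<close>
  speaks of sets, in which repeated members collapse, so a repetition P i = P j is treated apart and
  gives the relation P i - P j = 0.\<close>

lemma finite_dim_sequence_dependent:
  fixes P :: "nat \<Rightarrow> 'a::euclidean_space"
  obtains N c where "\<exists>k\<le>N. c k \<noteq> 0" "(\<Sum>k\<le>N. c k *\<^sub>R P k) = 0"
proof (cases "inj_on P {..DIM('a)}")
  case True
  then have "dependent (P ` {..DIM('a)})"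
    by (intro dependent_biggerset) (simp add: card_image)
  then obtain u where u: "\<exists>v\<in>P ` {..DIM('a)}. u v \<noteq> 0"
      "(\<Sum>v\<in>P ` {..DIM('a)}. u v *\<^sub>R v) = 0"
    by (subst (asm) dependent_finite) auto
  show ?thesis
    by (rule that[of "DIM('a)" "u \<circ> P"]) (use u True in \<open>auto simp: sum.reindex\<close>)
next
  case False
  then obtain i j where ij: "i \<le> DIM('a)" "j \<le> DIM('a)" "i \<noteq> j" "P i = P j"
    by (auto simp: inj_on_def)
  show ?thesis
  proof (rule that[of "DIM('a)" "\<lambda>k. (if k = i then 1 else 0) - (if k = j then 1 else 0)"])
    show "\<exists>k\<le>DIM('a). (if k = i then 1 else 0) - (if k = j then 1 else 0) \<noteq> (0::real)"
      using ij by (intro exI[of _ i]) auto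
    show "(\<Sum>k\<le>DIM('a). ((if k = i then 1 else 0) - (if k = j then 1 else 0)) *\<^sub>R P k) = 0"
      using ij by (simp add: scaleR_left_diff_distrib sum_subtractf if_distrib[of "\<lambda>c. c *\<^sub>R _"]
          cong: if_cong)
  qed
qed

text \<open>This is the vector q(M) v, with the powers of M written as iterates of the map v
  \<mapsto> M v.\<close>

definition poly_mat_vec :: "complex poly \<Rightarrow> complex ^ 'n ^ 'n \<Rightarrow> complex ^ 'n \<Rightarrow> complex ^ 'n"
  where "poly_mat_vec q M v = (\<Sum>k\<le>degree q. coeff q k *s (((*v) M) ^^ k) v)"

lemma poly_mat_vec_eq_sum:
  assumes "degree q \<le> n"
  shows "poly_mat_vec q M v = (\<Sum>k\<le>n. coeff q k *s (((*v) M) ^^ k) v)"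
  unfolding poly_mat_vec_def
  by (rule sum.mono_neutral_left) (use assms in \<open>auto simp: coeff_eq_0\<close>)

lemma funpow_mat_vec_diff:
  fixes M :: "complex ^ 'n ^ 'n"
  shows "(((*v) M) ^^ k) (x - c *s y) = (((*v) M) ^^ k) x - c *s (((*v) M) ^^ k) y"
proof (induction k)
  case (Suc k)
  then show ?case by (simp add: matrix_vector_mult_diff_distrib vector_scalar_commute)
qed simp

text \<open>Polynomials in M commute, so the factor M - a may act first. This is how one root is
  split off an annihilating polynomial.\<close>

lemma poly_mat_vec_linear_factor:
  "poly_mat_vec ([:-a, 1:] * r) M v = poly_mat_vec r M (M *v v - a *s v)"
proof -
  define n where "n = degree r"
  have "degree ([:-a, 1:] * r) \<le> Suc n"
    using degree_mult_le[of "[:-a, 1:]" r] by (simp add: n_def)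
  then have "poly_mat_vec ([:-a, 1:] * r) M v
      = (\<Sum>k\<le>Suc n. coeff ([:-a, 1:] * r) k *s (((*v) M) ^^ k) v)"
    by (rule poly_mat_vec_eq_sum)
  also have "[:-a, 1:] * r = pCons 0 r - smult a r"
    by (simp add: algebra_simps)
  also have "(\<Sum>k\<le>Suc n. coeff (pCons 0 r - smult a r) k *s (((*v) M) ^^ k) v)
     = (\<Sum>k\<le>Suc n. coeff (pCons 0 r) k *s (((*v) M) ^^ k) v)
       - (\<Sum>k\<le>Suc n. (a * coeff r k) *s (((*v) M) ^^ k) v)"
    by (simp only: coeff_diff coeff_smult vector_sub_rdistrib sum_subtractf)
  \<comment> \<open>Multiplication by the variable shifts the coefficients: the term at 0 vanishes,
    and one application of M moves to the argument.\<close>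
  also have "(\<Sum>k\<le>Suc n. coeff (pCons 0 r) k *s (((*v) M) ^^ k) v)
     = (\<Sum>k\<le>n. coeff r k *s (((*v) M) ^^ k) (M *v v))"
    by (subst sum.atMost_Suc_shift) (simp add: funpow_Suc_right del: funpow.simps)
  \<comment> \<open>The top term drops out because \<open>coeff r (Suc n) = 0\<close>.\<close>
  also have "(\<Sum>k\<le>Suc n. (a * coeff r k) *s (((*v) M) ^^ k) v)
     = (\<Sum>k\<le>n. coeff r k *s (a *s (((*v) M) ^^ k) v))"
    by (simp add: n_def coeff_eq_0 vector_smult_assoc mult.commute)
  finally show ?thesis
    by (simp add: poly_mat_vec_def n_def funpow_mat_vec_diff sum_subtractf vector_ssub_ldistrib)
qed

text \<open>The powers of M lie in a finite-dimensional real space, so some of them satisfy a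
  nontrivial real linear relation, whose coefficients are those of q. As the relation holds between
  matrices, one q serves all vectors.\<close>

lemma annihilating_poly_exists:
  fixes M :: "complex ^ 'n ^ 'n"
  obtains q where "q \<noteq> 0" "\<And>v. poly_mat_vec q M v = 0"
proof -
  define P where "P k = (((**) M) ^^ k) (mat 1)" for k
  have P: "P k *v v = (((*v) M) ^^ k) v" for k v
    by (induction k arbitrary: v) (auto simp: P_def simp flip: matrix_vector_mul_assoc)
  obtain N c where c: "\<exists>k\<le>N. c k \<noteq> 0" "(\<Sum>k\<le>N. c k *\<^sub>R P k) = 0"
    by (rule finite_dim_sequence_dependent[of P])
  define q where "q = (\<Sum>k\<le>N. monom (complex_of_real (c k)) k)"
  have q: "coeff q k = (if k \<le> N then of_real (c k) else 0)" for k
    by (simp add: q_def coeff_sum)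
  show ?thesis
  proof (rule that[of q])
    show "q \<noteq> 0" using c(1) q by (metis coeff_0 of_real_eq_0_iff)
    fix v
    have "degree q \<le> N" by (rule degree_le) (simp add: q)
    then have "poly_mat_vec q M v = (\<Sum>k\<le>N. complex_of_real (c k) *s (P k *v v))"
      by (simp add: poly_mat_vec_eq_sum q P)
    also have "\<dots> = (\<Sum>k\<le>N. c k *\<^sub>R P k) *v v"
    \<comment> \<open>The complex scaling \<open>*s\<close> of vectors and the real scaling of
      matrices are compared entry by entry, where both are products of complex numbers.\<close>
    proof (rule vec_eq_iff[THEN iffD2], rule allI)
      fix i
      have "(\<Sum>k\<le>N. complex_of_real (c k) *s (P k *v v)) $ i
          = (\<Sum>k\<le>N. \<Sum>j\<in>UNIV. (c k *\<^sub>R P k $ i $ j) * v $ j)"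
        by (simp add: matrix_vector_mult_def sum_distrib_left mult.assoc scaleR_conv_of_real[where 'a = complex])
      also have "\<dots> = (\<Sum>j\<in>UNIV. \<Sum>k\<le>N. (c k *\<^sub>R P k $ i $ j) * v $ j)"
        by (rule sum.swap)
      also have "\<dots> = ((\<Sum>k\<le>N. c k *\<^sub>R P k) *v v) $ i"
        by (simp add: matrix_vector_mult_def sum_distrib_right)
      finally show "(\<Sum>k\<le>N. complex_of_real (c k) *s (P k *v v)) $ i
          = ((\<Sum>k\<le>N. c k *\<^sub>R P k) *v v) $ i" .
    qed
    also have "\<dots> = 0" by (simp add: c(2))
    finally show "poly_mat_vec q M v = 0" .
  qed
qed

section \<open>Decay of the solutions of Hurwitz systems\<close>

lemma has_vector_derivative_vec_nth:
  "(w has_vector_derivative w') F \<Longrightarrow> ((\<lambda>t. w t $ i) has_vector_derivative w' $ i) F"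
  by (rule bounded_linear.has_vector_derivative[OF bounded_linear_vec_nth])

lemma bounded_linear_mat_vec_diff_scaled:
  "bounded_linear (\<lambda>v. M *v v - a *s (v :: complex ^ 'n))"
  unfolding linear_conv_bounded_linear[symmetric]
proof (rule linearI)
  fix r :: real and v :: "complex ^ 'n"
  have r: "r *\<^sub>R u = complex_of_real r *s u" for u :: "complex ^ 'n"
    by (simp add: vec_eq_iff scaleR_conv_of_real[where 'a = complex])
  show "M *v (r *\<^sub>R v) - a *s (r *\<^sub>R v) = r *\<^sub>R (M *v v - a *s v)"
    by (simp add: r vector_scalar_commute vector_ssub_ldistrib vector_smult_assoc mult.commute)
qed (simp add: matrix_vector_right_distrib vector_add_ldistrib)

text \<open>
  Induction on the annihilating polynomial: for a root \<open>a\<close>, the curve \<open>u = M w - a w\<close> is annihilated by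
  the cofactor, so it tends to \<open>0\<close>. If \<open>a\<close> is an eigenvalue, each component of \<open>w\<close> solves the stable
  scalar equation \<open>w' = a w + u\<close>; otherwise \<open>M - a\<close> is invertible and \<open>w\<close> is recovered from \<open>u\<close>.
\<close>

lemma annihilated_ode_tendsto_0:
  fixes M :: "complex ^ 'n ^ 'n"
  assumes M: "\<And>c. matrix_eigenvalue M c \<Longrightarrow> Re c < 0"
    and "q \<noteq> 0" "\<And>t. t \<ge> t0 \<Longrightarrow> poly_mat_vec q M (w t) = 0"
    and "\<And>t. t \<ge> t0 \<Longrightarrow> (w has_vector_derivative M *v w t) (at t within {t0..})"
  shows "(w \<longlongrightarrow> 0) at_top"
  using assms(2-)
proof (induction "degree q" arbitrary: q w)
  case 0
  \<comment> \<open>A nonzero constant polynomial acts as an invertible scalar, so it annihilates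
    only the zero curve.\<close>
  then have "w t = 0" if "t \<ge> t0" for t
    using that "0.prems"(2)[of t] by (auto simp: poly_mat_vec_def vec_eq_iff elim!: degree_eq_zeroE)
  then have "eventually (\<lambda>t. w t = 0) at_top"
    by (auto simp: eventually_at_top_linorder)
  then show ?case by (rule tendsto_eventually)
next
  case (Suc n)
  have "\<not> constant (poly q)" using Suc.hyps by (simp add: constant_degree)
  then obtain a where "poly q a = 0"
    using fundamental_theorem_of_algebra by blast
  then obtain r where r: "q = [:-a, 1:] * r" by (auto simp: poly_eq_0_iff_dvd)
  then have r0: "r \<noteq> 0" using Suc.prems by auto
  then have deg: "n = degree r" using Suc.hyps by (simp add: r degree_mult_eq del: mult_pCons_left)
  define u where "u t = M *v w t - a *s w t" for t
  have u: "(u \<longlongrightarrow> 0) at_top"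
  proof (rule Suc.hyps(1)[OF deg r0])
    fix t assume t: "t \<ge> t0"
    show "poly_mat_vec r M (u t) = 0"
      using Suc.prems(2)[OF t] by (simp only: r poly_mat_vec_linear_factor u_def)
    \<comment> \<open>M commutes with M - a, so u solves the same equation as w.\<close>
    have "(u has_vector_derivative M *v (M *v w t) - a *s (M *v w t)) (at t within {t0..})"
      unfolding u_def
      by (rule bounded_linear.has_vector_derivative[OF bounded_linear_mat_vec_diff_scaled Suc.prems(3)[OF t]])
    then show "(u has_vector_derivative M *v u t) (at t within {t0..})"
      by (simp add: u_def matrix_vector_mult_diff_distrib vector_scalar_commute)
  qed
  \<comment> \<open>The polynomial q is arbitrary, so its root a need not be an eigenvalue, and the
    assumption on M bounds Re a only if it is.\<close>
  show ?case
  proof (cases "matrix_eigenvalue M a")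
    case True
    show ?thesis
    proof (rule vec_tendstoI)
      fix i
      have "((\<lambda>t. w t $ i) \<longlongrightarrow> 0) at_top"
      proof (rule scalar_stable_ode_tendsto_0[where c = a and u = "\<lambda>t. u t $ i"])
        show "((\<lambda>t. w t $ i) has_vector_derivative a * w t $ i + u t $ i) (at t within {t0..})"
          if "t \<ge> t0" for t
          using has_vector_derivative_vec_nth[OF Suc.prems(3)[OF that], of i] by (simp add: u_def)
        show "((\<lambda>t. u t $ i) \<longlongrightarrow> 0) at_top" using tendsto_vec_nth[OF u] by simp
      qed (use M True in auto)
      then show "((\<lambda>t. w t $ i) \<longlongrightarrow> 0 $ i) at_top" by simp
    qed
  next
    case False
    let ?g = "\<lambda>v. M *v v - a *s v"
    have lin: "linear ?g"
      by (simp add: bounded_linear_mat_vec_diff_scaled bounded_linear.linear)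
    moreover have "inj ?g"
      using False by (auto simp: linear_injective_0[OF lin] matrix_eigenvalue_def)
    ultimately obtain g' where g': "linear g'" "g' \<circ> ?g = id"
      using linear_injective_left_inverse by blast
    then have "bounded_linear g'" by (simp add: linear_conv_bounded_linear)
    from bounded_linear.tendsto[OF this u] have "((\<lambda>t. g' (u t)) \<longlongrightarrow> 0) at_top"
      by (simp add: g'(1) linear_0)
    moreover have "g' (u t) = w t" for t
      using g'(2) by (simp add: u_def fun_eq_iff)
    ultimately show ?thesis by simp
  qed
qed

text \<open>The eigenvalues in \<open>hurwitz\<close> are complex, so the real curve is embedded
  into complex space by \<open>C\<close>, which intertwines A with its complexification M; real
  parts bring the limit back.\<close>

lemma hurwitz_ode_tendsto_0:
  fixes A :: "real ^ 'n ^ 'n"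
  assumes A: "hurwitz A"
    and w: "\<And>t. t \<ge> t0 \<Longrightarrow> (w has_vector_derivative A *v w t) (at t within {t0..})"
  shows "(w \<longlongrightarrow> 0) at_top"
proof -
  define M where "M = map_matrix complex_of_real A"
  define C where "C v = (\<chi> i. complex_of_real (v $ i))" for v :: "real ^ 'n"
  have "linear C"
    by (rule linearI) (auto simp: C_def vec_eq_iff scaleR_conv_of_real[where 'a = complex])
  then have C: "bounded_linear C" by (simp add: linear_conv_bounded_linear)
  have CA: "C (A *v v) = M *v C v" for v
    by (simp add: C_def M_def vec_eq_iff matrix_vector_mult_def)
  obtain q where q: "q \<noteq> 0" "\<And>v. poly_mat_vec q M v = 0"
    using annihilating_poly_exists by blast
  have "((\<lambda>t. C (w t)) \<longlongrightarrow> 0) at_top"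
  proof (rule annihilated_ode_tendsto_0[OF _ q])
    show "Re c < 0" if "matrix_eigenvalue M c" for c
      using A that by (simp add: hurwitz_def M_def)
    show "((\<lambda>t. C (w t)) has_vector_derivative M *v C (w t)) (at t within {t0..})"
      if "t \<ge> t0" for t
      using bounded_linear.has_vector_derivative[OF C w[OF that]] by (simp add: CA)
  qed
  then have Cw: "((\<lambda>t. C (w t) $ i) \<longlongrightarrow> 0) at_top" for i
    using tendsto_vec_nth by force
  show ?thesis
  proof (rule vec_tendstoI)
    fix i
    show "((\<lambda>t. w t $ i) \<longlongrightarrow> 0 $ i) at_top"
      using tendsto_Re[OF Cw[of i]] by (simp add: C_def)
  qed
qed

section \<open>Hausdorff-Lipschitz set-valued maps and separation of fibres\<close>

text \<open>Finiteness of the values turns the infimum in the Hausdorff excess into a minimum, so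
  the Lipschitz bound is realised by an actual point x' with the same constant k.\<close>

lemma hausdorff_lipschitz_nearest:
  fixes F :: "'a::metric_space \<Rightarrow> 'b::metric_space set"
  assumes "hausdorff_lipschitz F" and "\<And>z. finite (F z)"
  obtains k where "k > 0" "\<And>za zb x. x \<in> F za \<Longrightarrow> \<exists>x'\<in>F zb. dist x x' \<le> k * dist za zb"
proof -
  obtain k where k: "k > 0"
    "\<And>za zb. hausdorff_distance (F za) (F zb) \<le> ennreal (k * dist za zb)"
    using assms(1) by (auto simp: hausdorff_lipschitz_def)
  have "\<exists>x'\<in>F zb. dist x x' \<le> k * dist za zb" if x: "x \<in> F za" for za zb x
  proof -
    let ?I = "INF xb\<in>F zb. ennreal (dist x xb)"
    have "?I \<le> hausdorff_excess (F za) (F zb)"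
      unfolding hausdorff_excess_def by (rule SUP_upper[OF x])
    also have "\<dots> \<le> hausdorff_distance (F za) (F zb)"
      by (simp add: hausdorff_distance_def)
    also have "\<dots> \<le> ennreal (k * dist za zb)" by (rule k)
    finally have I: "?I \<le> ennreal (k * dist za zb)" .
    \<comment> \<open>An infimum over the empty set is infinite, against the finite bound
      \<open>I\<close>.\<close>
    have ne: "F zb \<noteq> {}"
    proof
      assume "F zb = {}"
      with I show False by (simp add: top_unique)
    qed
    have "?I = Min ((\<lambda>xb. ennreal (dist x xb)) ` F zb)"
      using ne assms(2) by (simp add: Min_Inf)
    also have "\<dots> \<in> (\<lambda>xb. ennreal (dist x xb)) ` F zb"
      using ne assms(2) by (intro Min_in) auto
    finally obtain x' where "x' \<in> F zb" "?I = ennreal (dist x x')" by auto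
    then show ?thesis
      using I k(1) by (intro bexI[of _ x']) (auto simp: ennreal_le_iff)
  qed
  then show ?thesis using that k(1) by blast
qed

text \<open>
  If two points of nearby fibres merged into one point \<open>x\<close>, these fibres would have one point more
  than the limit fibre through \<open>x\<close>, each of whose points continues to nearby fibres.
\<close>

lemma fibres_uniformly_separated:
  fixes T :: "'a::metric_space \<Rightarrow> 'b::metric_space"
  assumes X: "compact X" and T: "continuous_on X T"
    and card: "\<And>z. z \<in> T ` X \<Longrightarrow> finite (preimage_in T X z) \<and> card (preimage_in T X z) = p"
    and near: "\<And>za zb x. za \<in> T ` X \<Longrightarrow> zb \<in> T ` X \<Longrightarrow> x \<in> preimage_in T X za \<Longrightarrow>
        \<exists>x'\<in>preimage_in T X zb. dist x x' \<le> k * dist za zb"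
  obtains \<epsilon> where "\<epsilon> > 0"
    "\<And>a b. a \<in> X \<Longrightarrow> b \<in> X \<Longrightarrow> T a = T b \<Longrightarrow> a \<noteq> b \<Longrightarrow> dist a b \<ge> \<epsilon>"
proof -
  have "\<exists>\<epsilon>>0. \<forall>a\<in>X. \<forall>b\<in>X. T a = T b \<longrightarrow> a \<noteq> b \<longrightarrow> dist a b \<ge> \<epsilon>"
  proof (rule ccontr)
    assume "\<not> ?thesis"
    then have "\<forall>n. \<exists>a b. a \<in> X \<and> b \<in> X \<and> T a = T b \<and> a \<noteq> b \<and> dist a b < inverse (Suc n)"
      by (metis inverse_positive_iff_positive not_less of_nat_0_less_iff zero_less_Suc)
    then obtain a b where ab: "\<And>n. a n \<in> X" "\<And>n. b n \<in> X" "\<And>n. T (a n) = T (b n)"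
        "\<And>n. a n \<noteq> b n" "\<And>n. dist (a n) (b n) < inverse (Suc n)"
      by metis
    obtain x r where x: "x \<in> X" and r: "strict_mono r" and ax: "(a \<circ> r) \<longlonglongrightarrow> x"
      using X ab(1) by (meson compact_eq_seq_compact_metric seq_compact_def)
    let ?a = "a \<circ> r" and ?b = "b \<circ> r"
    have "(\<lambda>n. inverse (real (Suc (r n)))) \<longlonglongrightarrow> 0"
      using LIMSEQ_subseq_LIMSEQ[OF LIMSEQ_inverse_real_of_nat r] by (simp add: o_def)
    then have "(\<lambda>n. dist (?a n) (?b n)) \<longlonglongrightarrow> 0"
      by (rule Lim_null_comparison[rotated])
        (use ab(5) in \<open>auto intro!: always_eventually less_imp_le simp del: of_nat_Suc\<close>)
    moreover have "(\<lambda>n. dist (?a n) x) \<longlonglongrightarrow> 0"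
      using ax by (simp add: tendsto_dist_iff[symmetric] o_def)
    ultimately have "(\<lambda>n. dist (?a n) (?b n) + dist (?a n) x) \<longlonglongrightarrow> 0"
      by (rule tendsto_add_zero)
    then have "(\<lambda>n. dist (?b n) x) \<longlonglongrightarrow> 0"
      by (rule Lim_null_comparison[rotated]) (simp add: dist_triangle3)
    then have bx: "?b \<longlonglongrightarrow> x"
      by (simp only: tendsto_dist_iff[symmetric])
    have Ta: "(\<lambda>n. T (?a n)) \<longlonglongrightarrow> T x"
      using T x ax ab(1) by (auto simp: continuous_on_sequentially o_def)
    let ?F = "preimage_in T X (T x)"
    have F: "finite ?F" "card ?F = p" "x \<in> ?F"
      using card[of "T x"] x by (auto simp: preimage_in_def)
    \<comment> \<open>\<eta> is a lower bound for the gaps within the limit fibre. Displacements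
      below \<eta> / 2 are used so that two of them cannot join different points of it.\<close>
    obtain \<eta> where \<eta>: "\<eta> > 0" "\<And>u v. u \<in> ?F \<Longrightarrow> v \<in> ?F \<Longrightarrow> u \<noteq> v \<Longrightarrow> dist u v \<ge> \<eta>"
    proof -
      have "\<exists>d>0. \<forall>y\<in>?F. y \<noteq> u \<longrightarrow> d \<le> dist u y" for u
        by (rule finite_set_avoid[OF F(1)])
      then obtain d where d: "\<And>u. d u > 0" "\<And>u y. y \<in> ?F \<Longrightarrow> y \<noteq> u \<Longrightarrow> d u \<le> dist u y"
        by metis
      show thesis
      proof (rule that[of "Min (d ` ?F)"])
        show "Min (d ` ?F) > 0" using F d(1) by (subst Min_gr_iff) auto
        show "dist u v \<ge> Min (d ` ?F)" if "u \<in> ?F" "v \<in> ?F" "u \<noteq> v" for u v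
          using order_trans[OF Min_le d(2)[of v u]] that F(1) by simp
      qed
    qed
    have "(\<lambda>n. dist (T x) (T (?a n))) \<longlonglongrightarrow> 0"
      using Ta by (simp only: tendsto_dist_iff[of _ "T x"] dist_commute[of "T x"])
    then have "(\<lambda>n. k * dist (T x) (T (?a n))) \<longlonglongrightarrow> k * 0"
      by (rule tendsto_mult_left)
    then have "eventually (\<lambda>n. k * dist (T x) (T (?a n)) < \<eta> / 2) sequentially"
      using \<eta>(1) by (intro order_tendstoD[where y = "k * 0"]) auto
    moreover have "eventually (\<lambda>n. dist (?a n) x < \<eta> / 2) sequentially"
      "eventually (\<lambda>n. dist (?b n) x < \<eta> / 2) sequentially"
      using tendstoD[OF ax, of "\<eta> / 2"] tendstoD[OF bx, of "\<eta> / 2"] \<eta>(1) by simp_all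
    ultimately have "eventually (\<lambda>n. k * dist (T x) (T (?a n)) < \<eta> / 2 \<and>
        dist (?a n) x < \<eta> / 2 \<and> dist (?b n) x < \<eta> / 2) sequentially"
      by (simp add: eventually_conj_iff)
    then obtain n where n: "k * dist (T x) (T (?a n)) < \<eta> / 2"
        "dist (?a n) x < \<eta> / 2" "dist (?b n) x < \<eta> / 2"
      by (auto simp: eventually_sequentially)
    let ?G = "preimage_in T X (T (?a n))"
    have G: "finite ?G" "card ?G = p" "?a n \<in> ?G" "?b n \<in> ?G"
      using card[of "T (?a n)"] ab by (auto simp: preimage_in_def)
    have "\<exists>v\<in>?G. dist u v < \<eta> / 2" if u: "u \<in> ?F" for u
    proof -
      obtain v where "v \<in> ?G" "dist u v \<le> k * dist (T x) (T (?a n))"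
        using near[OF imageI[OF x] imageI[OF ab(1)[of "r n"]] u] by auto
      then show ?thesis using n(1) by (intro bexI[of _ v]) auto
    qed
    then obtain g0 where g0: "\<And>u. u \<in> ?F \<Longrightarrow> g0 u \<in> ?G \<and> dist u (g0 u) < \<eta> / 2"
      by metis
    \<comment> \<open>The partner of x is fixed to be \<open>?a n\<close>. Then \<open>?b n\<close>,
      which is also close to x, must be the partner of some other point of the limit fibre.\<close>
    define g where "g = g0(x := ?a n)"
    have g: "g u \<in> ?G" "dist u (g u) < \<eta> / 2" if "u \<in> ?F" for u
      using g0[OF that] G n(2) by (auto simp: g_def dist_commute)
    have inj: "inj_on g ?F"
    proof (rule inj_onI)
      fix u v assume uv: "u \<in> ?F" "v \<in> ?F" "g u = g v"
      have "dist u v < \<eta>"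
        using g(2)[OF uv(1)] g(2)[OF uv(2)] uv(3) dist_triangle2[of u v "g u"] by simp
      then show "u = v" using \<eta>(2) uv by force
    qed
    \<comment> \<open>Both fibres have p points, so the injection is onto and reaches
      \<open>?b n\<close>.\<close>
    then have "g ` ?F = ?G"
      using G F g(1) by (intro card_subset_eq) (auto simp: card_image)
    then obtain u where u: "u \<in> ?F" "g u = ?b n" using G(4) by (metis imageE)
    have "dist u x < \<eta>"
      using g(2)[OF u(1)] n(3) u(2) dist_triangle[of u x "?b n"] by simp
    then have "u = x" using \<eta>(2) u(1) F(3) by force
    then show False using u(2) ab(4)[of "r n"] by (simp add: g_def)
  qed
  then show ?thesis using that by blast
qed

section \<open>Continuous curves that approach a moving finite set\<close>

text \<open>
  While the gap lies outside \<open>[\<epsilon>/4, 3\<epsilon>/4]\<close>, continuity prevents it from switching sides.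
\<close>

lemma gap_dichotomy:
  fixes g E :: "real \<Rightarrow> real"
  assumes g: "continuous_on {t0..} g" and E: "(E \<longlongrightarrow> 0) at_top" and "\<epsilon> > 0"
    and gap: "\<And>t. t \<ge> t0 \<Longrightarrow> g t \<le> E t \<or> g t \<ge> \<epsilon> - E t"
    and nonneg: "\<And>t. g t \<ge> 0"
  shows "(g \<longlongrightarrow> 0) at_top \<or> eventually (\<lambda>t. g t > \<epsilon> / 2) at_top"
proof -
  have "eventually (\<lambda>t. E t < \<epsilon> / 4 \<and> t \<ge> t0) at_top"
    using E \<open>\<epsilon> > 0\<close> eventually_ge_at_top[of t0] by (intro eventually_conj order_tendstoD) auto
  then obtain t1 where t1: "\<And>t. t \<ge> t1 \<Longrightarrow> E t < \<epsilon> / 4 \<and> t \<ge> t0"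
    by (auto simp: eventually_at_top_linorder)
  have "connected (g ` {t1..})"
    using t1 by (intro connected_continuous_image continuous_on_subset[OF g]) auto
  \<comment> \<open>Intermediate values, with s and t in either order: a single low time after t1
    excludes high values at every time after t1.\<close>
  then have conn: "\<epsilon> / 2 \<in> g ` {t1..}"
    if "s \<ge> t1" "g s \<le> \<epsilon> / 2" "t \<ge> t1" "\<epsilon> / 2 \<le> g t" for s t
    using that by (auto simp: connected_iff_interval)
  \<comment> \<open>After t1 the error is below \<epsilon> / 4, so g is either below \<epsilon> / 4
    or above 3\<epsilon> / 4.\<close>
  have no: "\<epsilon> / 2 \<notin> g ` {t1..}"
    using gap t1 \<open>\<epsilon> > 0\<close> by fastforce
  show ?thesis
  proof (cases "\<exists>s\<ge>t1. g s \<le> \<epsilon> / 2")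
    case True
    then have "g t \<le> E t" if "t \<ge> t1" for t
      using conn no gap[of t] t1[OF that] that \<open>\<epsilon> > 0\<close> by fastforce
    then have "eventually (\<lambda>t. norm (g t) \<le> E t) at_top"
      using nonneg by (auto simp: eventually_at_top_linorder)
    then show ?thesis using E by (blast intro: Lim_null_comparison)
  next
    case False
    then have "\<forall>t\<ge>t1. g t > \<epsilon> / 2" by (meson not_le)
    then show ?thesis unfolding eventually_at_top_linorder by blast
  qed
qed

text \<open>The nearest points q and q' may jump with t, but at each time they either coincide or
  are \<epsilon> apart, which confines the continuous function \<open>dist (u t) (v t)\<close> to
  the two ranges of the gap dichotomy.\<close>

lemma tracking_dichotomy:
  fixes u v :: "real \<Rightarrow> 'a::metric_space"
  assumes u: "continuous_on {t0..} u" "(E \<longlongrightarrow> 0) at_top"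
      "\<forall>t\<ge>t0. \<exists>q\<in>F t. dist (u t) q \<le> E t"
    and v: "continuous_on {t0..} v" "(E' \<longlongrightarrow> 0) at_top"
      "\<forall>t\<ge>t0. \<exists>q\<in>F t. dist (v t) q \<le> E' t"
    and "\<epsilon> > 0"
    and sep: "\<forall>t\<ge>t0. \<forall>q\<in>F t. \<forall>q'\<in>F t. q \<noteq> q' \<longrightarrow> dist q q' \<ge> \<epsilon>"
  shows "((\<lambda>t. dist (u t) (v t)) \<longlongrightarrow> 0) at_top \<or> eventually (\<lambda>t. dist (u t) (v t) > \<epsilon> / 2) at_top"
proof (rule gap_dichotomy[where E = "\<lambda>t. E t + E' t"])
  show "continuous_on {t0..} (\<lambda>t. dist (u t) (v t))"
    using u(1) v(1) by (intro continuous_intros)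
  show "((\<lambda>t. E t + E' t) \<longlongrightarrow> 0) at_top"
    using tendsto_add[OF u(2) v(2)] by simp
  fix t assume t: "t \<ge> t0"
  obtain q q' where q: "q \<in> F t" "dist (u t) q \<le> E t" "q' \<in> F t" "dist (v t) q' \<le> E' t"
    using u(3) v(3) t by blast
  show "dist (u t) (v t) \<le> E t + E' t \<or> dist (u t) (v t) \<ge> \<epsilon> - (E t + E' t)"
  proof (cases "q = q'")
    case True
    then show ?thesis using q dist_triangle2[of "u t" "v t" q] by simp
  next
    case False
    then have "\<epsilon> \<le> dist q q'" using sep t q by blast
    also have "\<dots> \<le> dist q (u t) + dist (u t) (v t) + dist (v t) q'"
      using dist_triangle[of q q' "u t"] dist_triangle[of "u t" q' "v t"] by simp
    finally show ?thesis using q by (simp add: dist_commute)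
  qed
qed (use \<open>\<epsilon> > 0\<close> in auto)

lemma tracking_curve_asymptotic:
  fixes x :: "nat \<Rightarrow> real \<Rightarrow> 'a::metric_space"
  assumes card: "\<And>t. t \<ge> t0 \<Longrightarrow> finite (F t) \<and> card (F t) = p"
    and "\<epsilon> > 0"
    and sep: "\<forall>t\<ge>t0. \<forall>q\<in>F t. \<forall>q'\<in>F t. q \<noteq> q' \<longrightarrow> dist q q' \<ge> \<epsilon>"
    and x: "\<And>i. i \<in> {1..p} \<Longrightarrow> continuous_on {t0..} (x i)"
      "\<And>i. i \<in> {1..p} \<Longrightarrow> (E i \<longlongrightarrow> 0) at_top"
      "\<And>i. i \<in> {1..p} \<Longrightarrow> \<forall>t\<ge>t0. \<exists>q\<in>F t. dist (x i t) q \<le> E i t"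
    and v: "continuous_on {t0..} v" "(E' \<longlongrightarrow> 0) at_top"
      "\<forall>t\<ge>t0. \<exists>q\<in>F t. dist (v t) q \<le> E' t"
    and distinct: "\<And>i j. i \<in> {1..p} \<Longrightarrow> j \<in> {1..p} \<Longrightarrow> j \<noteq> i \<Longrightarrow>
        \<not> ((\<lambda>t. dist (x i t) (x j t)) \<longlongrightarrow> 0) at_top"
  shows "\<exists>i\<in>{1..p}. ((\<lambda>t. dist (v t) (x i t)) \<longlongrightarrow> 0) at_top"
proof (rule ccontr)
  assume contra: "\<not> ?thesis"
  have vx: "eventually (\<lambda>t. dist (v t) (x i t) > \<epsilon> / 2) at_top" if "i \<in> {1..p}" for i
    using tracking_dichotomy[OF v x[OF that] \<open>\<epsilon> > 0\<close> sep] contra that by blast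
  have xx: "eventually (\<lambda>t. \<forall>j\<in>{1..p}. j \<noteq> i \<longrightarrow> dist (x i t) (x j t) > \<epsilon> / 2) at_top"
    if i: "i \<in> {1..p}" for i
  proof (rule eventually_ball_finite, simp, intro ballI)
    fix j assume j: "j \<in> {1..p}"
    show "eventually (\<lambda>t. j \<noteq> i \<longrightarrow> dist (x i t) (x j t) > \<epsilon> / 2) at_top"
      using tracking_dichotomy[OF x[OF i] x[OF j] \<open>\<epsilon> > 0\<close> sep] distinct[OF i j]
      by (cases "j = i") auto
  qed
  \<comment> \<open>The contradiction arises at a single late time. Errors below \<epsilon> / 4 are
    small enough that two curves with a common nearby point would be less than \<epsilon> / 2
    apart.\<close>
  have "eventually (\<lambda>t. \<forall>i\<in>{1..p}. dist (v t) (x i t) > \<epsilon> / 2 \<and> E i t < \<epsilon> / 4 \<and>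
      (\<forall>j\<in>{1..p}. j \<noteq> i \<longrightarrow> dist (x i t) (x j t) > \<epsilon> / 2)) at_top"
  proof (rule eventually_ball_finite, simp, intro ballI)
    fix i assume i: "i \<in> {1..p}"
    have "eventually (\<lambda>t. E i t < \<epsilon> / 4) at_top"
      using x(2)[OF i] \<open>\<epsilon> > 0\<close> by (intro order_tendstoD) auto
    then show "eventually (\<lambda>t. dist (v t) (x i t) > \<epsilon> / 2 \<and> E i t < \<epsilon> / 4 \<and>
        (\<forall>j\<in>{1..p}. j \<noteq> i \<longrightarrow> dist (x i t) (x j t) > \<epsilon> / 2)) at_top"
      by (intro eventually_conj vx[OF i] xx[OF i])
  qed
  moreover have "eventually (\<lambda>t. E' t < \<epsilon> / 4) at_top"
    using v(2) \<open>\<epsilon> > 0\<close> by (intro order_tendstoD) auto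
  ultimately have "eventually (\<lambda>t. (\<forall>i\<in>{1..p}. dist (v t) (x i t) > \<epsilon> / 2 \<and> E i t < \<epsilon> / 4 \<and>
      (\<forall>j\<in>{1..p}. j \<noteq> i \<longrightarrow> dist (x i t) (x j t) > \<epsilon> / 2)) \<and> E' t < \<epsilon> / 4 \<and> t \<ge> t0) at_top"
    using eventually_ge_at_top[of t0] by (simp add: eventually_conj_iff)
  then obtain t where t: "t \<ge> t0" "E' t < \<epsilon> / 4"
    and far: "\<And>i. i \<in> {1..p} \<Longrightarrow> dist (v t) (x i t) > \<epsilon> / 2"
      "\<And>i. i \<in> {1..p} \<Longrightarrow> E i t < \<epsilon> / 4"
      "\<And>i j. i \<in> {1..p} \<Longrightarrow> j \<in> {1..p} \<Longrightarrow> j \<noteq> i \<Longrightarrow> dist (x i t) (x j t) > \<epsilon> / 2"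
    by (auto simp: eventually_at_top_linorder)
  have "\<exists>q. q \<in> F t \<and> dist (x i t) q < \<epsilon> / 4" if "i \<in> {1..p}" for i
    using x(3)[OF that] t(1) far(2)[OF that] by (blast intro: le_less_trans)
  then obtain q where q: "\<And>i. i \<in> {1..p} \<Longrightarrow> q i \<in> F t \<and> dist (x i t) (q i) < \<epsilon> / 4"
    by metis
  have "inj_on q {1..p}"
  proof (rule inj_onI, rule ccontr)
    fix i j assume ij: "i \<in> {1..p}" "j \<in> {1..p}" "q i = q j" "i \<noteq> j"
    then have "dist (x i t) (x j t) < \<epsilon> / 2"
      using q[OF ij(1)] q[OF ij(2)] dist_triangle2[of "x i t" "x j t" "q i"] by simp
    then show False using far(3)[of i j] ij by simp
  qed
  \<comment> \<open>p different points exhaust a set of p points, so the point close to v is close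
    to some x i as well.\<close>
  then have "q ` {1..p} = F t"
    using card[OF t(1)] q by (intro card_subset_eq) (auto simp: card_image)
  moreover obtain q' where q': "q' \<in> F t" "dist (v t) q' \<le> E' t"
    using v(3) t(1) by blast
  ultimately obtain i where i: "i \<in> {1..p}" "q' = q i" by (metis imageE)
  then have "dist (v t) (x i t) < \<epsilon> / 2"
    using q[OF i(1)] q' t(2) dist_triangle2[of "v t" "x i t" q'] by simp
  then show False using far(1)[OF i(1)] by simp
qed

section \<open>Solutions of the system and of the observer equation\<close>

lemma solves_ode_on_continuous_on: "solves_ode_on F x I \<Longrightarrow> continuous_on I x"
  by (auto simp: solves_ode_on_def continuous_on_eq_continuous_within
      intro: has_vector_derivative_continuous)

lemma solves_ode_on_subset: "solves_ode_on F x I \<Longrightarrow> J \<subseteq> I \<Longrightarrow> solves_ode_on F x J"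
  by (auto simp: solves_ode_on_def intro: has_vector_derivative_within_subset)

text \<open>The common input b cancels in the difference, which solves the homogeneous
  equation.\<close>

lemma hurwitz_solutions_asymptotic:
  fixes A :: "real ^ 'n ^ 'n"
  assumes "hurwitz A"
    and "solves_ode_on (\<lambda>t z. A *v z + b t) za {t0..}"
    and "solves_ode_on (\<lambda>t z. A *v z + b t) zb {t0..}"
  shows "((\<lambda>t. dist (za t) (zb t)) \<longlongrightarrow> 0) at_top"
proof -
  have "((\<lambda>t. za t - zb t) \<longlongrightarrow> 0) at_top"
  proof (rule hurwitz_ode_tendsto_0[OF assms(1)])
    fix t assume "t \<ge> t0"
    then have "(za has_vector_derivative A *v za t + b t) (at t within {t0..})"
      "(zb has_vector_derivative A *v zb t + b t) (at t within {t0..})"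
      using assms by (auto simp: solves_ode_on_def)
    from has_vector_derivative_diff[OF this]
    show "((\<lambda>t. za t - zb t) has_vector_derivative A *v (za t - zb t)) (at t within {t0..})"
      by (simp add: matrix_vector_mult_diff_distrib)
  qed
  then show ?thesis using tendsto_norm_zero by (force simp: dist_norm)
qed

text \<open>Chain rule. Here g may depend on t, since along the given solutions
  \<open>h (xs i t)\<close> is replaced by the signal \<open>y t\<close>; the partial differential
  equation for T then yields the assumption on g.\<close>

lemma solves_ode_on_image:
  fixes T :: "real ^ 'm \<Rightarrow> real ^ 'n"
  assumes x: "solves_ode_on (\<lambda>_. f) x I"
    and T: "\<And>t. t \<in> I \<Longrightarrow> T differentiable (at (x t))"
    and g: "\<And>t. t \<in> I \<Longrightarrow> jacobian T (at (x t)) *v f (x t) = g t (T (x t))"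
  shows "solves_ode_on g (\<lambda>t. T (x t)) I"
  unfolding solves_ode_on_def
proof
  fix t assume t: "t \<in> I"
  have "(T has_derivative (\<lambda>v. jacobian T (at (x t)) *v v)) (at (x t) within x ` I)"
    using T[OF t] by (simp add: jacobian_works has_derivative_at_withinI)
  moreover have "(x has_derivative (\<lambda>s. s *\<^sub>R f (x t))) (at t within I)"
    using x t by (simp add: solves_ode_on_def has_vector_derivative_def)
  ultimately have "((T \<circ> x) has_derivative (\<lambda>v. jacobian T (at (x t)) *v v) \<circ> (\<lambda>s. s *\<^sub>R f (x t)))
      (at t within I)"
    by (rule diff_chain_within[rotated])
  then show "((\<lambda>t. T (x t)) has_vector_derivative g t (T (x t))) (at t within I)"
    using g[OF t] by (simp add: has_vector_derivative_def o_def matrix_vector_mult_scaleR)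
qed

theorem theorem4:
  fixes f :: "real ^ 'nx \<Rightarrow> real ^ 'nx"
    and h :: "real ^ 'nx \<Rightarrow> real ^ 'ny"
    and \<O> \<X> :: "(real ^ 'nx) set"
    and A :: "real ^ 'nz ^ 'nz"
    and B :: "real ^ 'ny ^ 'nz"
    and T :: "real ^ 'nx \<Rightarrow> real ^ 'nz"
    and Tinv :: "real ^ 'nz \<Rightarrow> (real ^ 'nx) set"
    and p :: nat
    and y :: "real \<Rightarrow> real ^ 'ny"
    and tbar :: real
    and xs :: "nat \<Rightarrow> real \<Rightarrow> real ^ 'nx"
  assumes f_lipschitz: "local_lipschitz (UNIV :: real set) UNIV (\<lambda>_. f)"
    and h_cont: "continuous_on UNIV h"
    and dims: "CARD('nz) \<ge> CARD('nx)"
    and O_open: "open \<O>"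
    and X_compact: "compact \<X>"
    and X_sub: "\<X> \<subseteq> \<O>"
    and A_hurwitz: "hurwitz A"
    and T_C1: "C1_map_on T \<O>"
    and T_pde: "\<forall>x\<in>\<X>. jacobian T (at x) *v f x = A *v T x + B *v h x"
    and p_pos: "p \<ge> 1"
    and card_fibre: "\<forall>z\<in>T ` \<X>. card (preimage_in T \<X> z) = p"
    and full_rank: "\<forall>x\<in>\<X>. rank (jacobian T (at x)) = CARD('nx)"
    and Tinv_lipschitz: "hausdorff_lipschitz Tinv"
    and Tinv_fibre: "\<forall>z\<in>T ` \<X>. Tinv z = preimage_in T \<X> z"
    and Tinv_card: "\<forall>z. finite (Tinv z) \<and> card (Tinv z) \<le> p"
    and y_output: "\<exists>x. solves_ode_on (\<lambda>_. f) x {0..} \<and> (\<forall>t\<ge>0. y t = h (x t))"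
    and tbar_pos: "tbar > 0"
    and xs_sol: "\<forall>i\<in>{1..p}. solves_ode_on (\<lambda>_. f) (xs i) {tbar..}
                  \<and> (\<forall>t\<ge>tbar. xs i t \<in> \<X> \<and> h (xs i t) = y t)"
    and xs_distinct: "\<forall>i\<in>{1..p}. \<forall>j\<in>{1..p}. j \<noteq> i \<longrightarrow>
                       \<not> ((\<lambda>t. xs i t - xs j t) \<longlongrightarrow> 0) at_top"
    and cond4:
      "(\<exists>zs C. solves_ode_on (\<lambda>t z. A *v z + B *v y t) zs {0..} \<and> C \<subseteq> T ` \<X> \<and> C \<noteq> {}
            \<and> loops_contractible C \<and> ((\<lambda>t. infdist (zs t) C) \<longlongrightarrow> 0) at_top)
       \<or> (\<exists>zs \<tau>\<^sub>o \<delta>. solves_ode_on (\<lambda>t z. A *v z + B *v y t) zs {0..} \<and> \<tau>\<^sub>o > 0 \<and> \<delta> > 0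
            \<and> (\<forall>\<tau>\<ge>\<tau>\<^sub>o. loops_contractible (zs ` {\<tau>..\<tau> + \<delta>})))"
  shows "\<forall>z xhat. solves_ode_on (\<lambda>t z. A *v z + B *v y t) z {0..}
            \<and> continuous_on {0..} xhat \<and> (\<forall>t\<ge>0. xhat t \<in> Tinv (z t))
          \<longrightarrow> (\<exists>xtilde. solves_ode_on (\<lambda>_. f) xtilde {tbar..}
                \<and> (\<forall>t\<ge>tbar. h (xtilde t) = y t)
                \<and> ((\<lambda>t. norm (xhat t - xtilde t)) \<longlongrightarrow> 0) at_top)"
proof (intro allI impI, elim conjE)
  fix z xhat
  assume z: "solves_ode_on (\<lambda>t z. A *v z + B *v y t) z {0..}"
    and xhat: "continuous_on {0..} xhat" "\<forall>t\<ge>0. xhat t \<in> Tinv (z t)"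
  have one: "1 \<in> {1..p}" using p_pos by simp
  have diff: "T differentiable (at x)" if "x \<in> \<X>" for x
    using T_C1 X_sub that by (auto simp: C1_map_on_def)
  have fin: "finite (preimage_in T \<X> \<zeta>) \<and> card (preimage_in T \<X> \<zeta>) = p"
    if "\<zeta> \<in> T ` \<X>" for \<zeta>
    using Tinv_card Tinv_fibre card_fibre that by metis
  obtain k where k: "k > 0"
      "\<And>za zb x. x \<in> Tinv za \<Longrightarrow> \<exists>x'\<in>Tinv zb. dist x x' \<le> k * dist za zb"
    using hausdorff_lipschitz_nearest[OF Tinv_lipschitz] Tinv_card by metis
  obtain \<epsilon> where \<epsilon>: "\<epsilon> > 0"
      "\<And>a b. a \<in> \<X> \<Longrightarrow> b \<in> \<X> \<Longrightarrow> T a = T b \<Longrightarrow> a \<noteq> b \<Longrightarrow> dist a b \<ge> \<epsilon>"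
  proof (rule fibres_uniformly_separated[OF X_compact _ fin])
    show "continuous_on \<X> T"
      using diff by (simp add: continuous_at_imp_continuous_on differentiable_imp_continuous_within)
    show "\<exists>x'\<in>preimage_in T \<X> zb. dist x x' \<le> k * dist za zb"
      if "za \<in> T ` \<X>" "zb \<in> T ` \<X>" "x \<in> preimage_in T \<X> za" for za zb x
      using k(2)[of x za zb] Tinv_fibre that by simp
  qed auto
  have Txs: "solves_ode_on (\<lambda>t z. A *v z + B *v y t) (\<lambda>t. T (xs i t)) {tbar..}"
    if i: "i \<in> {1..p}" for i
  proof (rule solves_ode_on_image[where T = T and x = "xs i"])
    show "solves_ode_on (\<lambda>_. f) (xs i) {tbar..}" using xs_sol i by blast
    show "T differentiable (at (xs i t))" if "t \<in> {tbar..}" for t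
      using xs_sol i that by (intro diff) simp
    show "jacobian T (at (xs i t)) *v f (xs i t) = A *v T (xs i t) + B *v y t"
      if "t \<in> {tbar..}" for t
      using xs_sol i that T_pde by (metis atLeast_iff)
  qed
  \<comment> \<open>The comparison needs a common half-line, and the curves \<open>xs i\<close> are
    controlled only from \<open>tbar\<close> on.\<close>
  have z': "solves_ode_on (\<lambda>t z. A *v z + B *v y t) z {tbar..}"
    using tbar_pos by (intro solves_ode_on_subset[OF z]) auto
  define F where "F t = Tinv (T (xs 1 t))" for t
  have T1: "T (xs 1 t) \<in> T ` \<X>" if "t \<ge> tbar" for t
    using xs_sol one that by blast
  have F: "F t = preimage_in T \<X> (T (xs 1 t))" if "t \<ge> tbar" for t
    using Tinv_fibre T1[OF that] unfolding F_def by (rule bspec)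
  \<comment> \<open>Applied to z and to each T(x_i), this makes all the tracking errors vanish in
    the limit.\<close>
  have E: "((\<lambda>t. k * dist (\<zeta> t) (T (xs 1 t))) \<longlongrightarrow> 0) at_top"
    if "solves_ode_on (\<lambda>t z. A *v z + B *v y t) \<zeta> {tbar..}" for \<zeta>
    using tendsto_mult_right_zero[OF hurwitz_solutions_asymptotic[OF A_hurwitz that Txs[OF one]]] .
  have "\<exists>i\<in>{1..p}. ((\<lambda>t. dist (xhat t) (xs i t)) \<longlongrightarrow> 0) at_top"
  proof (rule tracking_curve_asymptotic[where F = F and ?t0.0 = tbar and \<epsilon> = \<epsilon>
        and E = "\<lambda>i t. k * dist (T (xs i t)) (T (xs 1 t))"
        and E' = "\<lambda>t. k * dist (z t) (T (xs 1 t))"])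
    show "finite (F t) \<and> card (F t) = p" if "t \<ge> tbar" for t
      using fin[OF T1[OF that]] F[OF that] by simp
    show "\<forall>t\<ge>tbar. \<forall>q\<in>F t. \<forall>q'\<in>F t. q \<noteq> q' \<longrightarrow> dist q q' \<ge> \<epsilon>"
      using \<epsilon>(2) F by (simp add: preimage_in_def)
    show "continuous_on {tbar..} (xs i)" if "i \<in> {1..p}" for i
      using xs_sol that by (blast intro: solves_ode_on_continuous_on)
    show "continuous_on {tbar..} xhat"
      using tbar_pos by (intro continuous_on_subset[OF xhat(1)]) auto
    show "\<forall>t\<ge>tbar. \<exists>q\<in>F t. dist (xs i t) q \<le> k * dist (T (xs i t)) (T (xs 1 t))"
      if "i \<in> {1..p}" for i
    proof (intro allI impI)
      fix t assume "t \<ge> tbar"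
      then have "xs i t \<in> \<X>" using xs_sol that by blast
      then have "xs i t \<in> Tinv (T (xs i t))" using Tinv_fibre by (simp add: preimage_in_def)
      then show "\<exists>q\<in>F t. dist (xs i t) q \<le> k * dist (T (xs i t)) (T (xs 1 t))"
        unfolding F_def by (rule k(2))
    qed
    \<comment> \<open>The Lipschitz bound is applied from \<open>z t\<close>, wherever it lies, to a
      point of T(X).\<close>
    show "\<forall>t\<ge>tbar. \<exists>q\<in>F t. dist (xhat t) q \<le> k * dist (z t) (T (xs 1 t))"
      unfolding F_def using xhat(2) tbar_pos by (intro allI impI k(2)) auto
    show "\<not> ((\<lambda>t. dist (xs i t) (xs j t)) \<longlongrightarrow> 0) at_top"
      if "i \<in> {1..p}" "j \<in> {1..p}" "j \<noteq> i" for i j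
      using xs_distinct that by (auto simp: dist_norm tendsto_norm_zero_iff)
  qed (use \<epsilon>(1) E Txs z' in auto)
  then obtain i where i: "i \<in> {1..p}" "((\<lambda>t. norm (xhat t - xs i t)) \<longlongrightarrow> 0) at_top"
    by (auto simp: dist_norm)
  \<comment> \<open>The solution sought is one of the given ones, so it generates y by
    assumption.\<close>
  then show "\<exists>xtilde. solves_ode_on (\<lambda>_. f) xtilde {tbar..} \<and> (\<forall>t\<ge>tbar. h (xtilde t) = y t)
      \<and> ((\<lambda>t. norm (xhat t - xtilde t)) \<longlongrightarrow> 0) at_top"
    using xs_sol by (intro exI[of _ "xs i"]) auto
qed

end
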